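(* Let $a>0$ and $b>0$. With $V(p,n,a,\beta,x)$ and $\Upsilon_e,\Upsilon_o$ as defined in the context, the following hold on $(0,\infty)$: (i) for $p\in\{0,1,2\}$, $$\sqrt{2\pi}\int x^{\frac12+p}e^{-ax^{2}}b^{\frac12}J_{\frac12}(bx)\,dx=\int 2e^{-ax^{2}}x^{p}\sin(bx)\,dx=iV(p,0,a,ib,x)-iV(p,0,a,-ib,x),$$ and for $p=0$ this equals $\frac{i\sqrt\pi}{2\sqrt a}e^{-\frac{b^{2}}{4a}}\left(\operatorname{erf}\left(\frac{2ax+ib}{2\sqrt a}\right)-\operatorname{erf}\left(\frac{2ax-ib}{2\sqrt a}\right)\right)$; (ii) $$\sqrt{2\pi}\int x^{\frac12-1}e^{-ax^{2}}b^{\frac32}J_{\frac32}(bx)\,dx=\int\frac bx e^{-ax^{2}}\left(-2\cos(bx)+\frac{2\sin(bx)}{bx}\right)dx$$ $$=i\sqrt\pi\sqrt a\,e^{-\frac{b^{2}}{4a}}\operatorname{erf}\left(\frac{2ax-ib}{2\sqrt a}\right)-i\sqrt\pi\sqrt a\,e^{-\frac{b^{2}}{4a}}\operatorname{erf}\left(\frac{2ax+ib}{2\sqrt a}\right)+\frac ix\left(e^{-ax^{2}+ibx}-e^{-ax^{2}-ibx}\right)$$ $$=iV(-1,1,a,ib,x)-iV(-1,1,a,-ib,x);$$ (iii) $$\sqrt{2\pi}\int x^{\frac12}e^{-ax^{2}}b^{\frac32}J_{\frac32}(bx)\,dx=\int be^{-ax^{2}}\left(-2\cos(bx)+\frac{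2\sin(bx)}{bx}\right)dx=-2b\,\Upsilon_e(0,a,ib,x)+2i\,\Upsilon_o(1,a,ib,x).$$
   Context: $J_\mu$ is the Bessel function of the first kind; $\operatorname{erf}(z)=\frac{2}{\sqrt\pi}\int_0^z e^{-t^2}dt$ is the entire error function; $\Gamma(s,z)=\int_z^\infty t^{s-1}e^{-t}dt$. For $\beta\in\mathbb{C}$, with $E=e^{-ax^{2}-\beta x}$ and $W=\sqrt\pi\,e^{\frac{\beta^{2}}{4a}}\operatorname{erf}\left(\frac{2ax+\beta}{2\sqrt a}\right)$: $$V(0,0,a,\beta,x)=\frac{W}{2\sqrt a},\quad V(1,0,a,\beta,x)=-\frac{E}{2a}-\frac{\beta W}{4a^{3/2}},$$ $$V(2,0,a,\beta,x)=\frac{(\beta-2ax)E}{4a^{2}}+\frac{(2a+\beta^{2})W}{8a^{5/2}},\quad V(-1,1,a,\beta,x)=-\sqrt a\,W-\frac Ex.$$ For $x>0$ and $\beta\in\mathbb{C}$, $$\Upsilon_e(\upsilon,a,\beta,x)=-\sum_{k=0}^\infty\frac{\beta^{2k}a^{-k+\frac\upsilon2-\frac12}\Gamma\left(k-\frac\upsilon2+\frac12,ax^2\right)}{2(2k)!},\quad \Upsilon_o(\upsilon,a,\beta,x)=\sum_{k=0}^\infty\frac{\beta^{2k+1}a^{-k+\frac\upsilon2-1}\Gamma\left(k-\frac\upsilon2+1,ax^2\right)}{2(2k+1)!}.$$ An identity $\int f\,dx=\int g\,dx=F$ means that $f=g$ on $(0,\infty)$ and $F$ is an antiderivative of it there.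 *)

theory Defs
  imports "HOL-Complex_Analysis.Complex_Analysis"
begin

text \<open>Bessel function of the first kind, by its power series, with the principal branch of
  \<open>(z / 2) powr \<mu>\<close>. As \<open>rGamma\<close> vanishes at the poles of the Gamma function, negative integer
  orders are covered; \<open>\<mu> = 0\<close> is separated because \<open>0 powr 0 = 0\<close>.\<close>

definition bessel_J :: "complex \<Rightarrow> complex \<Rightarrow> complex" where
  "bessel_J \<mu> z = (if \<mu> = 0 then 1 else (z / 2) powr \<mu>) *
     (\<Sum>k. (- 1) ^ k * rGamma (of_nat k + \<mu> + 1) / fact k * (z / 2) ^ (2 * k))"

definition erf :: "complex \<Rightarrow> complex" where
  "erf z = 2 / complex_of_real (sqrt pi) * contour_integral (linepath 0 z) (\<lambda>t. exp (- (t ^ 2)))"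

text \<open>The upper incomplete Gamma function, needed only for a positive real second argument.\<close>

definition upper_Gamma :: "complex \<Rightarrow> real \<Rightarrow> complex" where
  "upper_Gamma s z = integral {z..} (\<lambda>t. complex_of_real t powr (s - 1) * exp (- complex_of_real t))"

definition V_exp :: "real \<Rightarrow> complex \<Rightarrow> real \<Rightarrow> complex" where
  "V_exp a \<beta> x = exp (- complex_of_real (a * x ^ 2) - \<beta> * complex_of_real x)"

definition V_erf :: "real \<Rightarrow> complex \<Rightarrow> real \<Rightarrow> complex" where
  "V_erf a \<beta> x = complex_of_real (sqrt pi) * exp (\<beta> ^ 2 / complex_of_real (4 * a)) *
     erf ((complex_of_real (2 * a * x) + \<beta>) / complex_of_real (2 * sqrt a))"

text \<open>Closed forms of \<open>V(p, n, a, \<beta>, x)\<close> for the index pairs \<open>(p, n)\<close> at which they are given.\<close>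

definition V :: "int \<Rightarrow> int \<Rightarrow> real \<Rightarrow> complex \<Rightarrow> real \<Rightarrow> complex" where
  "V p n a \<beta> x =
    (let E = V_exp a \<beta> x; W = V_erf a \<beta> x in
     if (p, n) = (0, 0) then W / complex_of_real (2 * sqrt a)
     else if (p, n) = (1, 0) then
       - E / complex_of_real (2 * a) - \<beta> * W / complex_of_real (4 * a powr (3 / 2))
     else if (p, n) = (2, 0) then
       (\<beta> - complex_of_real (2 * a * x)) * E / complex_of_real (4 * a ^ 2)
         + (complex_of_real (2 * a) + \<beta> ^ 2) * W / complex_of_real (8 * a powr (5 / 2))
     else if (p, n) = (- 1, 1) then
       - complex_of_real (sqrt a) * W - E / complex_of_real x
     else undefined)"

definition Upsilon_e :: "complex \<Rightarrow> real \<Rightarrow> complex \<Rightarrow> real \<Rightarrow> complex" where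
  "Upsilon_e \<upsilon> a \<beta> x =
    - (\<Sum>k. \<beta> ^ (2 * k) * complex_of_real a powr (- of_nat k + \<upsilon> / 2 - 1 / 2) *
         upper_Gamma (of_nat k - \<upsilon> / 2 + 1 / 2) (a * x ^ 2) / (2 * fact (2 * k)))"

definition Upsilon_o :: "complex \<Rightarrow> real \<Rightarrow> complex \<Rightarrow> real \<Rightarrow> complex" where
  "Upsilon_o \<upsilon> a \<beta> x =
    (\<Sum>k. \<beta> ^ (2 * k + 1) * complex_of_real a powr (- of_nat k + \<upsilon> / 2 - 1) *
       upper_Gamma (of_nat k - \<upsilon> / 2 + 1) (a * x ^ 2) / (2 * fact (2 * k + 1)))"

text \<open>The identity \<open>\<integral> f dx = \<integral> g dx = F\<close> between indefinite integrals on \<open>(0, \<infinity>)\<close>.\<close>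

definition indefinite_integrals_eq ::
  "(real \<Rightarrow> complex) \<Rightarrow> (real \<Rightarrow> complex) \<Rightarrow> (real \<Rightarrow> complex) \<Rightarrow> bool" where
  "indefinite_integrals_eq f g F \<longleftrightarrow>
    (\<forall>x>0. f x = g x \<and> (F has_vector_derivative f x) (at x))"

end

theory Submission
  imports Defs
begin

text \<open>The Bessel functions of orders 1/2 and 3/2 are elementary: the duplication formula turns
  their power series into those of sine and cosine. Since
  \<open>2 sin (b x) = \<i> (exp (- \<i> b x) - exp (\<i> b x))\<close>, the first two parts follow by differentiating
  the closed forms of \<open>V\<close> at \<open>\<beta> = \<plusminus> \<i> b\<close>. For the third, each term of the \<open>\<Upsilon>\<close> series has derivative
  \<open>\<plusminus> exp (- a x\<^sup>2)\<close> times a term of the series of \<open>cos (b x)\<close> or \<open>sin (b x) / x\<close>.\<close>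

text \<open>The parameters of the two \<open>\<Upsilon>\<close> series are matched to their parity:
  with 0 in the even series and 1 in the odd one, both contain the incomplete Gamma function at
  \<open>k + 1 / 2\<close> and the factor \<open>a powr (- (k + 1 / 2))\<close>. One termwise
  differentiation with arbitrary real coefficients \<open>c k\<close> therefore serves both, and it
  can be done over the reals, since at \<open>\<beta> = \<i> b\<close> the even series is real and
  the odd one is \<open>\<i>\<close> times a real series. The obstacle is the convergence of the
  undifferentiated series, because the incomplete Gamma values grow like factorials in
  \<open>k\<close>. The coefficients win: up to powers of \<open>b\<close> they are at most
  \<open>1 / fact (2 * k)\<close>, which is at most \<open>1 / (fact k * fact k)\<close>.\<close>

section \<open>The error function and the closed forms of \<open>V\<close>\<close>

lemma erf_has_field_derivative:
  "(erf has_field_derivative 2 / complex_of_real (sqrt pi) * exp (- (z ^ 2))) (at z)"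
proof -
  have "(\<lambda>t. exp (- (t ^ 2))) holomorphic_on (UNIV :: complex set)"
    by (intro holomorphic_intros)
  then obtain g where g: "(g has_field_derivative exp (- (t ^ 2))) (at t)" for t :: complex
    using holomorphic_convex_primitive'[OF convex_UNIV open_UNIV] by (metis UNIV_I)
  \<comment> \<open>A global primitive turns the integral over a segment that moves with
    \<open>w\<close> into \<open>g w - g 0\<close>, which can be differentiated directly.\<close>
  have "((\<lambda>t. exp (- (t ^ 2))) has_contour_integral g w - g 0) (linepath 0 w)" for w
    using contour_integral_primitive[of UNIV g "\<lambda>t. exp (- (t ^ 2))" "linepath 0 w"] g by simp
  then have "erf = (\<lambda>w. 2 / complex_of_real (sqrt pi) * (g w - g 0))"
    unfolding erf_def[abs_def] by (intro ext arg_cong2[of _ _ _ _ "(*)"] refl contour_integral_unique)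
  moreover have "((\<lambda>w. 2 / complex_of_real (sqrt pi) * (g w - g 0)) has_field_derivative
      2 / complex_of_real (sqrt pi) * exp (- (z ^ 2))) (at z)"
    by (auto intro!: derivative_eq_intros g)
  ultimately show ?thesis by (simp only:)
qed

text \<open>The expression makes sense for complex \<open>x\<close>; it is differentiated there and
  then restricted to the real line. The next lemma proceeds in the same way.\<close>

lemma V_exp_has_vector_derivative:
  "(V_exp a \<beta> has_vector_derivative - (complex_of_real (2 * a * x) + \<beta>) * V_exp a \<beta> x) (at x)"
proof -
  have "((\<lambda>z. exp (- complex_of_real a * z ^ 2 - \<beta> * z)) has_field_derivative
      - (complex_of_real (2 * a * x) + \<beta>) * V_exp a \<beta> x) (at (complex_of_real x))"
    by (auto intro!: derivative_eq_intros simp: V_exp_def algebra_simps)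
  from has_vector_derivative_real_field[OF this] show ?thesis
    by (simp add: V_exp_def[abs_def])
qed

text \<open>Completing the square: \<open>\<beta>^2 / (4 a)\<close> minus the square of the argument
  of \<open>erf\<close> equals \<open>- a x^2 - \<beta> x\<close>, so the Gaussian from the
  derivative of \<open>erf\<close> combines with the prefactor into \<open>V_exp\<close>.\<close>

lemma V_erf_has_vector_derivative:
  assumes "a > 0"
  shows "(V_erf a \<beta> has_vector_derivative complex_of_real (2 * sqrt a) * V_exp a \<beta> x) (at x)"
proof -
  \<comment> \<open>With \<open>d\<close> opaque, the algebra needs only \<open>d \<noteq> 0\<close>
    and \<open>d ^ 2 = 4 a\<close>, and no simplification of square roots.\<close>
  define d where "d = complex_of_real (2 * sqrt a)"
  have d: "d \<noteq> 0" "d ^ 2 = complex_of_real (4 * a)"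
    using assms by (auto simp: d_def power_mult_distrib simp flip: of_real_power)
  have a: "complex_of_real a \<noteq> 0" using assms by simp
  have sp: "complex_of_real (sqrt pi) \<noteq> 0" by simp
  let ?u = "\<lambda>z. (complex_of_real (2 * a) * z + \<beta>) / d"
  have E: "exp (\<beta> ^ 2 / complex_of_real (4 * a)) * exp (- (?u (of_real x) ^ 2)) = V_exp a \<beta> x"
    using a unfolding exp_add[symmetric] V_exp_def power_divide d
    by (intro arg_cong[of _ _ exp]) (simp add: field_simps power2_eq_square)
  have two_a: "2 * complex_of_real (2 * a) / d = d"
    using d by (simp add: field_simps power2_eq_square)
  have "((\<lambda>z. complex_of_real (sqrt pi) * exp (\<beta> ^ 2 / complex_of_real (4 * a)) * erf (?u z))
      has_field_derivative complex_of_real (sqrt pi) * exp (\<beta> ^ 2 / complex_of_real (4 * a)) *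
        (2 / complex_of_real (sqrt pi) * exp (- (?u (of_real x) ^ 2)) * (complex_of_real (2 * a) / d)))
      (at (complex_of_real x))"
    using d(1) by (auto intro!: derivative_eq_intros DERIV_chain2[OF erf_has_field_derivative])
  also have "complex_of_real (sqrt pi) * exp (\<beta> ^ 2 / complex_of_real (4 * a)) *
        (2 / complex_of_real (sqrt pi) * exp (- (?u (of_real x) ^ 2)) * (complex_of_real (2 * a) / d)) =
      (2 * complex_of_real (2 * a) / d) * V_exp a \<beta> x"
    unfolding E[symmetric] using sp by simp
  also have "\<dots> = d * V_exp a \<beta> x" unfolding two_a ..
  finally show ?thesis
    by (auto dest: has_vector_derivative_real_field simp: V_erf_def[abs_def] d_def)
qed

text \<open>Differentiating the \<open>V_exp\<close> part gives \<open>x^p * V_exp\<close> and a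
  multiple of \<open>V_exp\<close> that is constant in \<open>x\<close>; the coefficient of
  \<open>V_erf\<close> is the one that cancels this multiple.\<close>

lemma V_has_vector_derivative:
  assumes "a > 0" and "p \<in> {0, 1, 2}"
  shows "(V p 0 a \<beta> has_vector_derivative complex_of_real (x powi p) * V_exp a \<beta> x) (at x)"
proof -
  note [derivative_intros] = V_exp_has_vector_derivative V_erf_has_vector_derivative[OF assms(1)]
  \<comment> \<open>In terms of \<open>s\<close> the powers of \<open>a\<close> with exponents 1/2,
    3/2 and 5/2 become integer powers, so the three cases reduce to rational identities.\<close>
  define s where "s = sqrt a"
  have s: "s > 0" "a = s ^ 2" using assms by (auto simp: s_def)
  have roots: "a powr (3 / 2) = s ^ 3" "a powr (5 / 2) = s ^ 5" "sqrt a = s"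
    using s by (simp_all add: powr_powr real_sqrt_unique flip: powr_numeral)
  have nz: "complex_of_real s \<noteq> 0" using s by simp
  from assms(2) consider "p = 0" | "p = 1" | "p = 2" by blast
  then show ?thesis
  proof cases
    case 1
    then have "V p 0 a \<beta> = (\<lambda>x. V_erf a \<beta> x / complex_of_real (2 * s))"
      by (simp add: V_def[abs_def] Let_def roots)
    moreover have "(\<dots> has_vector_derivative
        (complex_of_real (2 * s) * V_exp a \<beta> x) / complex_of_real (2 * s)) (at x)"
      by (rule derivative_intros | simp only: flip: roots(3))+
    ultimately show ?thesis using 1 nz by simp
  next
    case 2
    then have "V p 0 a \<beta> = (\<lambda>x. - V_exp a \<beta> x / complex_of_real (2 * a)
        - \<beta> * V_erf a \<beta> x / complex_of_real (4 * s ^ 3))"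
      by (simp add: V_def[abs_def] Let_def roots)
    moreover have "(\<dots> has_vector_derivative
        - (- (complex_of_real (2 * a * x) + \<beta>) * V_exp a \<beta> x) / complex_of_real (2 * a)
        - \<beta> * (complex_of_real (2 * s) * V_exp a \<beta> x) / complex_of_real (4 * s ^ 3)) (at x)"
      by (intro derivative_intros has_vector_derivative_mult_right
          V_erf_has_vector_derivative[OF assms(1), unfolded roots])
    moreover have "- (- (complex_of_real (2 * a * x) + \<beta>) * e) / complex_of_real (2 * a)
        - \<beta> * (complex_of_real (2 * s) * e) / complex_of_real (4 * s ^ 3) = complex_of_real (x powi 1) * e" for e
      using nz unfolding s(2) by (simp add: field_simps power2_eq_square power3_eq_cube)
    ultimately show ?thesis by (simp only: 2)
  next
    case 3
    then have "V p 0 a \<beta> = (\<lambda>x. (\<beta> - complex_of_real (2 * a * x)) * V_exp a \<beta> x / complex_of_real (4 * a ^ 2)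
        + (complex_of_real (2 * a) + \<beta> ^ 2) * V_erf a \<beta> x / complex_of_real (8 * s ^ 5))"
      by (simp add: V_def[abs_def] Let_def roots)
    moreover have "(\<dots> has_vector_derivative
        ((\<beta> - complex_of_real (2 * a * x)) * (- (complex_of_real (2 * a * x) + \<beta>) * V_exp a \<beta> x)
         + (0 - complex_of_real (2 * a)) * V_exp a \<beta> x) / complex_of_real (4 * a ^ 2)
        + (complex_of_real (2 * a) + \<beta> ^ 2) * (complex_of_real (2 * s) * V_exp a \<beta> x)
          / complex_of_real (8 * s ^ 5)) (at x)"
      by (intro derivative_intros has_vector_derivative_mult_right
          V_erf_has_vector_derivative[OF assms(1), unfolded roots])
        (auto intro!: derivative_eq_intros)
    moreover have "((\<beta> - complex_of_real (2 * a * x)) * (- (complex_of_real (2 * a * x) + \<beta>) * e)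
         + (0 - complex_of_real (2 * a)) * e) / complex_of_real (4 * a ^ 2)
        + (complex_of_real (2 * a) + \<beta> ^ 2) * (complex_of_real (2 * s) * e)
          / complex_of_real (8 * s ^ 5) = complex_of_real (x powi 2) * e" for e
      using nz unfolding s(2) by (simp add: field_simps) (simp add: algebra_simps power_numeral_reduce)
    ultimately show ?thesis by (simp only: 3)
  qed
qed

text \<open>The derivative of \<open>- V_exp / x\<close> contains the term
  \<open>2 a * V_exp\<close>, and the summand \<open>- sqrt a * V_erf\<close> removes it.\<close>

lemma V_minus_one_has_vector_derivative:
  assumes "a > 0" and "x > 0"
  shows "(V (- 1) 1 a \<beta> has_vector_derivative
     (1 + \<beta> * complex_of_real x) / complex_of_real (x ^ 2) * V_exp a \<beta> x) (at x)"
proof -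
  have nz: "complex_of_real x \<noteq> 0" using assms by simp
  have sq: "complex_of_real (sqrt a) * complex_of_real (sqrt a) = complex_of_real a"
    using assms by (simp flip: of_real_mult)
  have "V (- 1) 1 a \<beta> = (\<lambda>x. - (complex_of_real (sqrt a) * V_erf a \<beta> x) - V_exp a \<beta> x * complex_of_real (1 / x))"
    by (simp add: V_def[abs_def] Let_def divide_inverse)
  moreover have "(\<dots> has_vector_derivative
        - (complex_of_real (sqrt a) * (complex_of_real (2 * sqrt a) * V_exp a \<beta> x))
        - (V_exp a \<beta> x * complex_of_real (- 1 / x ^ 2)
           + - (complex_of_real (2 * a * x) + \<beta>) * V_exp a \<beta> x * complex_of_real (1 / x))) (at x)"
    using assms by (intro derivative_intros has_vector_derivative_mult_right
          V_exp_has_vector_derivative V_erf_has_vector_derivative)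
        (auto intro!: derivative_eq_intros simp: power2_eq_square)
  moreover have "- (complex_of_real (sqrt a) * (complex_of_real (2 * sqrt a) * e))
        - (e * complex_of_real (- 1 / x ^ 2)
           + - (complex_of_real (2 * a * x) + \<beta>) * e * complex_of_real (1 / x)) =
      (1 + \<beta> * complex_of_real x) / complex_of_real (x ^ 2) * e" for e
    using nz by (simp add: field_simps power2_eq_square flip: sq)
  ultimately show ?thesis by simp
qed

section \<open>Bessel functions of orders 1/2 and 3/2\<close>

text \<open>The instance of the duplication formula that is needed, in reciprocal form as in the
  Bessel series. It follows from the value of Gamma at 1/2 by the recurrence, each step dividing by
  \<open>k + 3 / 2\<close>.\<close>

lemma rGamma_half_integer:
  "rGamma (of_nat k + 3 / 2 :: complex) =
     complex_of_real (2 ^ (2 * k + 1) * fact k / (sqrt pi * fact (2 * k + 1)))"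
proof (induction k)
  case 0
  have "rGamma (1 / 2 :: complex) = 1 / 2 * rGamma (3 / 2)"
    using rGamma_plus1[of "1 / 2 :: complex"] by simp
  then show ?case
    by (simp add: rGamma_inverse_Gamma Gamma_one_half_complex field_simps)
next
  case (Suc k)
  have nz: "(of_nat k + 3 / 2 :: complex) = of_real ((2 * real k + 3) / 2)" by simp
  have "rGamma (of_nat k + 3 / 2 :: complex) =
      of_real ((2 * real k + 3) / 2) * rGamma (of_nat (Suc k) + 3 / 2)"
    using rGamma_plus1[of "of_nat k + 3 / 2 :: complex"] by (simp only: nz[symmetric]) (simp add: add_ac)
  then have "rGamma (of_nat (Suc k) + 3 / 2 :: complex) =
      rGamma (of_nat k + 3 / 2 :: complex) / of_real ((2 * real k + 3) / 2)"
    by (subst nonzero_eq_divide_eq) (auto simp: mult.commute simp del: of_real_divide)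
  also have "\<dots> = complex_of_real (2 ^ (2 * k + 1) * fact k / (sqrt pi * fact (2 * k + 1)) / ((2 * real k + 3) / 2))"
    unfolding Suc.IH by simp
  also have "2 ^ (2 * k + 1) * fact k / (sqrt pi * fact (2 * k + 1)) / ((2 * real k + 3) / 2) =
      2 ^ (2 * Suc k + 1) * fact (Suc k) / (sqrt pi * fact (2 * Suc k + 1))"
  proof -
    have "fact (2 * Suc k + 1) = (2 * real k + 3) * (2 * (real k + 1)) * fact (2 * k + 1)"
      by (simp add: algebra_simps)
    then show ?thesis by (simp add: divide_simps del: fact_Suc) (simp add: algebra_simps)
  qed
  finally show ?case .
qed

lemma bessel_J_one_half:
  assumes "z > 0"
  shows "bessel_J (1 / 2) (complex_of_real z) = complex_of_real (sqrt (2 / (pi * z)) * sin z)"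
proof -
  \<comment> \<open>In the Bessel term all powers of 2 but one cancel against those of
    \<open>rGamma\<close>, and \<open>z ^ (2 * k)\<close> is one factor \<open>z\<close> short of
    the sine series.\<close>
  let ?c = "2 / (sqrt pi * z)"
  have "(\<lambda>k. complex_of_real (?c * ((- 1) ^ k / fact (2 * k + 1) * z ^ (2 * k + 1))))
      sums complex_of_real (?c * sin z)"
    by (intro sums_of_real sums_mult sin_paired)
  moreover have "complex_of_real (?c * ((- 1) ^ k / fact (2 * k + 1) * z ^ (2 * k + 1))) =
     (- 1) ^ k * rGamma (of_nat k + 1 / 2 + 1) / fact k * (of_real z / 2) ^ (2 * k)" for k
  proof -
    have "(of_nat k + 1 / 2 + 1 :: complex) = of_nat k + 3 / 2" by simp
    then have "(- 1) ^ k * rGamma (of_nat k + 1 / 2 + 1) / fact k * (of_real z / 2) ^ (2 * k) =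
      complex_of_real ((- 1) ^ k * (2 ^ (2 * k + 1) * fact k / (sqrt pi * fact (2 * k + 1))) / fact k * (z / 2) ^ (2 * k))"
      by (simp only: rGamma_half_integer) simp
    also have "(- 1) ^ k * (2 ^ (2 * k + 1) * fact k / (sqrt pi * fact (2 * k + 1))) / fact k * (z / 2) ^ (2 * k) =
       ?c * ((- 1) ^ k / fact (2 * k + 1) * z ^ (2 * k + 1))"
      using assms by (simp add: power_divide del: fact_Suc)
    finally show ?thesis by simp
  qed
  ultimately have "(\<Sum>k. (- 1) ^ k * rGamma (of_nat k + 1 / 2 + 1) / fact k * (of_real z / 2) ^ (2 * k)) =
     complex_of_real (?c * sin z)" by (simp add: sums_iff)
  moreover have "(complex_of_real z / 2) powr (1 / 2) = complex_of_real (sqrt (z / 2))"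
    using powr_of_real[of "z / 2" "1 / 2"] assms by (simp add: powr_half_sqrt)
  ultimately have "bessel_J (1 / 2) (complex_of_real z) = complex_of_real (sqrt (z / 2) * (?c * sin z))"
    by (simp add: bessel_J_def)
  also have "sqrt (z / 2) * ?c = sqrt (2 / (pi * z))"
    using assms by (intro real_sqrt_unique[symmetric]) (auto simp: power_mult_distrib power_divide power2_eq_square)
  then have "sqrt (z / 2) * (?c * sin z) = sqrt (2 / (pi * z)) * sin z"
    by (metis mult.assoc)
  finally show ?thesis .
qed

lemma bessel_J_three_halves:
  assumes "z > 0"
  shows "bessel_J (3 / 2) (complex_of_real z) =
     complex_of_real (sqrt (2 / (pi * z)) * (sin z / z - cos z))"
proof -
  let ?c = "4 / (sqrt pi * z ^ 2)"
  \<comment> \<open>The terms of \<open>sin z / z - cos z\<close>. The one at index 0 is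
    \<open>1 - 1\<close>, so the series starts at index 1, which matches the Gamma argument
    \<open>k + 5 / 2 = Suc k + 3 / 2\<close> of order 3/2.\<close>
  let ?f = "\<lambda>k. (- 1) ^ k / fact (2 * k + 1) * z ^ (2 * k + 1) / z - (- 1) ^ k / fact (2 * k) * z ^ (2 * k)"
  have "?f sums (sin z / z - cos z)"
    by (intro sums_diff sums_divide sin_paired cos_paired)
  moreover have "?f 0 = 0" using assms by simp
  ultimately have "(\<lambda>k. ?f (Suc k)) sums (sin z / z - cos z)"
    using sums_Suc_iff[of ?f "sin z / z - cos z"] by simp
  then have "(\<lambda>k. complex_of_real (?c * ?f (Suc k))) sums complex_of_real (?c * (sin z / z - cos z))"
    by (intro sums_of_real sums_mult)
  moreover have "complex_of_real (?c * ?f (Suc k)) =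
     (- 1) ^ k * rGamma (of_nat k + 3 / 2 + 1) / fact k * (of_real z / 2) ^ (2 * k)" for k
  proof -
    have "(of_nat k + 3 / 2 + 1 :: complex) = of_nat (Suc k) + 3 / 2" by simp
    then have "(- 1) ^ k * rGamma (of_nat k + 3 / 2 + 1) / fact k * (of_real z / 2) ^ (2 * k) =
      complex_of_real ((- 1) ^ k * (2 ^ (2 * Suc k + 1) * fact (Suc k) / (sqrt pi * fact (2 * Suc k + 1))) / fact k * (z / 2) ^ (2 * k))"
      by (simp only: rGamma_half_integer) simp
    also have "(- 1) ^ k * (2 ^ (2 * Suc k + 1) * fact (Suc k) / (sqrt pi * fact (2 * Suc k + 1))) / fact k * (z / 2) ^ (2 * k) =
       ?c * ?f (Suc k)"
    proof -
      have f: "fact (2 * Suc k + 1) = (2 * real k + 3) * fact (2 * Suc k)" by simp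
      have "z ^ (2 * Suc k + 1) / z = z ^ (2 * Suc k)" using assms by simp
      then have "?f (Suc k) = - ((- 1) ^ k) * z ^ (2 * Suc k) * (1 / fact (2 * Suc k + 1) - 1 / fact (2 * Suc k))"
        by (simp add: right_diff_distrib del: fact_Suc)
      \<comment> \<open>This difference supplies the factor \<open>2 * (k + 1)\<close> that
        \<open>fact (Suc k) / fact k\<close> produces on the Bessel side.\<close>
      also have "1 / fact (2 * Suc k + 1) - 1 / fact (2 * Suc k) = - (2 * real k + 2) / fact (2 * Suc k + 1)"
        unfolding f by (simp add: divide_simps del: fact_Suc)
      finally have "?f (Suc k) = (- 1) ^ k * z ^ (2 * k) * z ^ 2 * (2 * real k + 2) / fact (2 * Suc k + 1)"
        by (simp add: power2_eq_square algebra_simps del: fact_Suc)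
      moreover have "fact (Suc k) = (real k + 1) * fact k" by simp
      ultimately show ?thesis
        using assms by (simp add: power_divide del: fact_Suc)
    qed
    finally show ?thesis by simp
  qed
  ultimately have "(\<Sum>k. (- 1) ^ k * rGamma (of_nat k + 3 / 2 + 1) / fact k * (of_real z / 2) ^ (2 * k)) =
     complex_of_real (?c * (sin z / z - cos z))" by (simp add: sums_iff)
  moreover have "(complex_of_real z / 2) powr (3 / 2) = complex_of_real (z / 2 * sqrt (z / 2))"
  proof -
    have "(complex_of_real z / 2) powr (3 / 2) = complex_of_real ((z / 2) powr (3 / 2))"
      using powr_of_real[of "z / 2" "3 / 2"] assms by simp
    also have "(z / 2) powr (3 / 2) = z / 2 * sqrt (z / 2)"
      using powr_add[of "z / 2" 1 "1 / 2"] assms by (simp add: powr_half_sqrt)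
    finally show ?thesis .
  qed
  moreover have "(3 / 2 = (0 :: complex)) = False" by simp
  ultimately have "bessel_J (3 / 2) (complex_of_real z) =
      complex_of_real (z / 2 * sqrt (z / 2) * (?c * (sin z / z - cos z)))"
    by (simp only: bessel_J_def if_False of_real_mult)
  also have "z / 2 * sqrt (z / 2) * ?c = sqrt (2 / (pi * z))"
    using assms by (intro real_sqrt_unique[symmetric])
      (auto simp: power_mult_distrib power_divide power2_eq_square)
  then have "z / 2 * sqrt (z / 2) * (?c * (sin z / z - cos z)) = sqrt (2 / (pi * z)) * (sin z / z - cos z)"
    by (metis mult.assoc)
  finally show ?thesis .
qed

section \<open>The upper incomplete Gamma function and its series\<close>

text \<open>A real-valued version, so that estimates by monotonicity and real differentiation are
  available.\<close>

definition real_upper_Gamma :: "real \<Rightarrow> real \<Rightarrow> real" where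
  "real_upper_Gamma s y = integral {y..} (\<lambda>t. t powr (s - 1) * exp (- t))"

text \<open>The integrand of the complete Gamma function is absolutely integrable on the positive
  half-line; it is restricted to \<open>{y..}\<close>, and its norm is the real integrand.\<close>

lemma upper_Gamma_integrand_integrable:
  fixes s y :: real
  assumes "s > 0" and "y > 0"
  shows "(\<lambda>t. t powr (s - 1) * exp (- t)) absolutely_integrable_on {y..}"
proof -
  have "(\<lambda>t. complex_of_real t powr (complex_of_real s - 1) / of_real (exp t)) absolutely_integrable_on {0<..}"
    using absolutely_integrable_Gamma_integral'[of "complex_of_real s"] assms by simp
  then have "(\<lambda>t. complex_of_real t powr (complex_of_real s - 1) / of_real (exp t)) absolutely_integrable_on {y..}"
    by (rule set_integrable_subset) (use assms in auto)
  then have "(\<lambda>t. norm (complex_of_real t powr (complex_of_real s - 1) / of_real (exp t))) absolutely_integrable_on {y..}"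
    by (rule set_integrable_norm)
  then show ?thesis
    by (rule set_integrable_cong[THEN iffD1, rotated -1])
      (use assms in \<open>auto simp: norm_divide norm_powr_real_powr exp_minus field_simps\<close>)
qed

lemma upper_Gamma_of_real:
  assumes "s > 0" and "y > 0"
  shows "upper_Gamma (complex_of_real s) y = complex_of_real (real_upper_Gamma s y)"
proof -
  have "((\<lambda>t. t powr (s - 1) * exp (- t)) has_integral real_upper_Gamma s y) {y..}"
    unfolding real_upper_Gamma_def
    using upper_Gamma_integrand_integrable[OF assms]
    by (intro integrable_integral set_lebesgue_integral_eq_integral)
  then have "((\<lambda>t. complex_of_real (t powr (s - 1) * exp (- t))) has_integral
      complex_of_real (real_upper_Gamma s y)) {y..}"
    by (rule has_integral_of_real)
  then have "((\<lambda>t. complex_of_real t powr (complex_of_real s - 1) * exp (- complex_of_real t)) has_integral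
      complex_of_real (real_upper_Gamma s y)) {y..}"
    by (rule has_integral_eq[rotated])
      (use assms powr_of_real[of _ "s - 1"] in \<open>auto simp flip: exp_of_real\<close>)
  then show ?thesis unfolding upper_Gamma_def by (rule integral_unique)
qed

text \<open>Cutting the half-line at \<open>2 * y\<close> leaves a tail that does not depend on the
  lower limit, and an integral over a compact interval to which the fundamental theorem applies. The
  window from \<open>y / 2\<close> to \<open>2 * y\<close> has \<open>y\<close> in its interior and
  stays away from the singularity at 0.\<close>

lemma real_upper_Gamma_has_real_derivative:
  assumes "s > 0" and "y > 0"
  shows "(real_upper_Gamma s has_real_derivative - (y powr (s - 1) * exp (- y))) (at y)"
proof -
  let ?f = "\<lambda>t::real. t powr (s - 1) * exp (- t)"
  have y: "y \<in> {y / 2<..<2 * y}" using assms by auto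
  have "((\<lambda>u. integral {u..2 * y} ?f) has_real_derivative - ?f y) (at y within {y / 2..2 * y})"
    using assms by (intro integral_has_real_derivative' continuous_intros) auto
  then have "((\<lambda>u. integral {u..2 * y} ?f) has_real_derivative - ?f y) (at y)"
    using y at_within_Icc_at[of "y / 2" y "2 * y"] by simp
  then have "((\<lambda>u. integral {u..2 * y} ?f + real_upper_Gamma s (2 * y)) has_real_derivative - ?f y) (at y)"
    by (auto intro!: derivative_eq_intros)
  moreover have "real_upper_Gamma s u = integral {u..2 * y} ?f + real_upper_Gamma s (2 * y)"
    if "u \<in> {y / 2<..<2 * y}" for u
  proof -
    have "?f absolutely_integrable_on {2 * y..}"
      using that assms by (intro upper_Gamma_integrand_integrable) auto
    then have i2: "?f integrable_on {2 * y..}" by (rule set_lebesgue_integral_eq_integral)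
    have i1: "?f integrable_on {u..2 * y}"
      using that assms by (intro integrable_continuous_real continuous_intros) auto
    have "{u..2 * y} \<union> {2 * y..} = {u..}" "{u..2 * y} \<inter> {2 * y..} = {2 * y}"
      using that by auto
    then show ?thesis
      using integral_Un[OF i1 i2] by (simp add: real_upper_Gamma_def)
  qed
  ultimately show ?thesis
    using has_field_derivative_transform_within_open[of _ _ y "{y / 2<..<2 * y}" "real_upper_Gamma s"] y
    by (metis (no_types, lifting) open_greaterThanLessThan)
qed

text \<open>On \<open>t \<ge> 1\<close> raising the exponent by 1/2 only increases the integrand,
  and extending the domain to \<open>{0..}\<close> then gives the complete integral for
  \<open>fact k\<close>.\<close>

lemma real_upper_Gamma_half_integer_le_fact:
  assumes "y \<ge> 1"
  shows "\<bar>real_upper_Gamma (real k + 1 / 2) y\<bar> \<le> fact k"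
proof -
  let ?f = "\<lambda>t. t powr (real k + 1 / 2 - 1) * exp (- t)"
  let ?g = "\<lambda>t. t powr (real k + 1 - 1) / exp t"
  have f: "?f integrable_on {y..}"
    using assms by (intro set_lebesgue_integral_eq_integral upper_Gamma_integrand_integrable) auto
  have "(\<lambda>t. t powr (real k + 1 - 1) * exp (- t)) integrable_on {y..}"
    using assms by (intro set_lebesgue_integral_eq_integral upper_Gamma_integrand_integrable) auto
  then have g: "?g integrable_on {y..}" by (simp add: exp_minus divide_inverse)
  have g0: "(?g has_integral fact k) {0..}"
    using Gamma_integral_real[of "real k + 1"] Gamma_fact[of k, where 'a = real] by (simp add: add.commute)
  have "0 \<le> real_upper_Gamma (real k + 1 / 2) y"
    unfolding real_upper_Gamma_def using f by (intro integral_nonneg) auto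
  moreover have "real_upper_Gamma (real k + 1 / 2) y \<le> integral {y..} ?g"
    unfolding real_upper_Gamma_def
  proof (rule integral_le[OF f g])
    fix t assume "t \<in> {y..}"
    then have "?f t \<le> t powr (real k + 1 - 1) * exp (- t)"
      using assms by (intro mult_right_mono powr_mono) auto
    also have "\<dots> = ?g t" by (simp only: exp_minus divide_inverse)
    finally show "?f t \<le> ?g t" .
  qed
  moreover have "integral {y..} ?g \<le> integral {0..} ?g"
    using assms by (intro integral_subset_le g has_integral_integrable[OF g0]) auto
  ultimately show ?thesis unfolding integral_unique[OF g0] by linarith
qed

text \<open>Termwise differentiation: the series of derivatives converges uniformly on bounded intervals,
  and the series itself converges at \<open>x = 1 / sqrt a\<close>, where the incomplete Gamma values are at
  most \<open>k!\<close>.\<close>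

lemma upper_Gamma_series:
  fixes c :: "nat \<Rightarrow> real"
  assumes "a > 0" and "x > 0" and c: "\<And>r. summable (\<lambda>k. \<bar>c k\<bar> * fact k * r ^ k)"
  defines "T \<equiv> (\<lambda>k x. c k * a powr (- (real k + 1 / 2)) * real_upper_Gamma (real k + 1 / 2) (a * x ^ 2) / 2)"
  shows "summable (\<lambda>k. T k x)"
    and "((\<lambda>x. \<Sum>k. T k x) has_real_derivative - exp (- a * x ^ 2) * (\<Sum>k. c k * x ^ (2 * k))) (at x)"
proof -
  \<comment> \<open>The open interval from 0 to \<open>R\<close> contains both the point of
    differentiation and the point at which the series is summed.\<close>
  define R where "R = x + 1 / sqrt a + 1"
  define T' where "T' = (\<lambda>k x. - exp (- a * x ^ 2) * (c k * x ^ (2 * k)))"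
  have sc: "summable (\<lambda>k. \<bar>c k\<bar> * r ^ k)" if "r \<ge> 0" for r
    by (rule summable_comparison_test[OF _ c[of r]])
      (use that in \<open>auto intro!: exI[of _ 0] mult_right_mono simp: mult_le_cancel_left1\<close>)
  have R: "x \<in> {0<..<R}" "1 / sqrt a \<in> {0<..<R}"
    using assms by (auto simp: R_def add_pos_pos)
  have deriv: "(T k has_real_derivative T' k u) (at u)" if "u > 0" for k u
  proof -
    \<comment> \<open>The inner derivative \<open>2 * a * u\<close> makes up for the fractional
      exponents: the power of \<open>u\<close> becomes the integer \<open>2 * k\<close>, and that of
      \<open>a\<close> cancels against the normalisation in \<open>T\<close>.\<close>
    have "(a * u ^ 2) powr (real k + 1 / 2 - 1) * (2 * a * u) =
        2 * a powr (real k + 1 / 2) * u ^ (2 * k)"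
    proof -
      have "(u ^ 2) powr (real k + 1 / 2 - 1) = u powr (2 * real k - 1)"
        using that by (simp add: powr_powr algebra_simps flip: powr_numeral)
      also have "\<dots> * u = u powr (2 * real k - 1 + 1)"
        using that by (subst powr_add) simp
      also have "\<dots> = u ^ (2 * k)"
        using that by (simp flip: powr_realpow)
      finally have "(u ^ 2) powr (real k + 1 / 2 - 1) * u = u ^ (2 * k)" .
      moreover have "a powr (real k + 1 / 2 - 1) * a = a powr (real k + 1 / 2)"
        using assms powr_add[of a "real k + 1 / 2 - 1" 1] by (simp add: add.commute)
      moreover have "(a * u ^ 2) powr (real k + 1 / 2 - 1) * (2 * a * u) =
          2 * (a powr (real k + 1 / 2 - 1) * a) * ((u ^ 2) powr (real k + 1 / 2 - 1) * u)"
        using assms that by (simp add: powr_mult)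
      ultimately show ?thesis by (simp only:)
    qed
    moreover have "((\<lambda>x. real_upper_Gamma (real k + 1 / 2) (a * x ^ 2)) has_real_derivative
        - ((a * u ^ 2) powr (real k + 1 / 2 - 1) * exp (- (a * u ^ 2))) * (2 * a * u)) (at u)"
      using assms that
      by (intro DERIV_chain2[OF real_upper_Gamma_has_real_derivative]) (auto intro!: derivative_eq_intros)
    moreover have "- ((a * u ^ 2) powr (real k + 1 / 2 - 1) * exp (- (a * u ^ 2))) * (2 * a * u) =
        - ((a * u ^ 2) powr (real k + 1 / 2 - 1) * (2 * a * u) * exp (- (a * u ^ 2)))"
      by simp
    ultimately have "((\<lambda>x. real_upper_Gamma (real k + 1 / 2) (a * x ^ 2)) has_real_derivative
        - (2 * a powr (real k + 1 / 2) * u ^ (2 * k) * exp (- (a * u ^ 2)))) (at u)"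
      by (simp only:)
    then have "(T k has_real_derivative c k * a powr (- (real k + 1 / 2)) *
        (- (2 * a powr (real k + 1 / 2) * u ^ (2 * k) * exp (- (a * u ^ 2)))) / 2) (at u)"
      unfolding T_def by (intro DERIV_cdivide DERIV_cmult)
    then show ?thesis
      using assms by (simp add: T'_def powr_minus field_simps)
  qed
  have unif: "uniformly_convergent_on {0<..<R} (\<lambda>n x. \<Sum>k<n. T' k x)"
  proof (rule Weierstrass_m_test')
    show "summable (\<lambda>k. \<bar>c k\<bar> * (R ^ 2) ^ k)" by (rule sc) simp
    show "norm (T' k u) \<le> \<bar>c k\<bar> * (R ^ 2) ^ k" if "u \<in> {0<..<R}" for k u
    proof -
      have "exp (- a * u ^ 2) * (\<bar>c k\<bar> * u ^ (2 * k)) \<le> 1 * (\<bar>c k\<bar> * R ^ (2 * k))"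
        using that assms by (intro mult_mono power_mono) auto
      then show ?thesis by (simp add: T'_def abs_mult power_mult power2_eq_square)
    qed
  qed
  have start: "summable (\<lambda>k. T k (1 / sqrt a))"
  proof (rule summable_comparison_test)
    show "summable (\<lambda>k. a powr (- 1 / 2) / 2 * (\<bar>c k\<bar> * fact k * (1 / a) ^ k))"
      by (intro summable_mult c)
    have "norm (T k (1 / sqrt a)) \<le> a powr (- 1 / 2) / 2 * (\<bar>c k\<bar> * fact k * (1 / a) ^ k)" for k
    proof -
      let ?g = "real_upper_Gamma (real k + 1 / 2) (a * (1 / sqrt a) ^ 2)"
      have "a powr (- (real k + 1 / 2)) = a powr (- 1 / 2) * (1 / a) ^ k"
        using assms powr_add[of a "- real k" "- 1 / 2"]
        by (simp add: powr_minus powr_realpow power_one_over inverse_eq_divide)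
      then have "norm (T k (1 / sqrt a)) = a powr (- 1 / 2) / 2 * (\<bar>c k\<bar> * \<bar>?g\<bar> * (1 / a) ^ k)"
        using assms by (simp only: T_def) (simp add: abs_mult power_abs mult_ac)
      \<comment> \<open>At \<open>1 / sqrt a\<close> the second argument is exactly 1, where the
        factorial bound applies.\<close>
      moreover have "\<bar>?g\<bar> \<le> fact k"
        using assms by (intro real_upper_Gamma_half_integer_le_fact) (simp add: power_divide)
      ultimately show ?thesis
        using assms by (simp only:) (intro mult_left_mono mult_right_mono; simp)
    qed
    then show "\<exists>N. \<forall>k\<ge>N. norm (T k (1 / sqrt a)) \<le> a powr (- 1 / 2) / 2 * (\<bar>c k\<bar> * fact k * (1 / a) ^ k)"
      by blast
  qed
  have "summable (\<lambda>k. c k * x ^ (2 * k))"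
    by (rule summable_rabs_cancel) (use sc[of "x ^ 2"] in \<open>simp add: abs_mult power_mult\<close>)
  then have lim: "(\<Sum>k. T' k x) = - exp (- a * x ^ 2) * (\<Sum>k. c k * x ^ (2 * k))"
    unfolding T'_def by (rule suminf_mult)
  have deriv_within: "(T k has_real_derivative T' k u) (at u within {0<..<R})" if "u \<in> {0<..<R}" for k u
    by (rule has_field_derivative_at_within[OF deriv]) (use that in simp)
  have int: "x \<in> interior {0<..<R}" using R by (simp add: interior_open)
  note series = has_field_derivative_series'[OF _ deriv_within unif R(2) start int]
  show "summable (\<lambda>k. T k x)"
    by (rule series) simp
  show "((\<lambda>x. \<Sum>k. T k x) has_real_derivative - exp (- a * x ^ 2) * (\<Sum>k. c k * x ^ (2 * k))) (at x)"
    unfolding lim[symmetric] by (rule series) simp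
qed

section \<open>Integrands and antiderivatives at
  \<open>\<beta> = \<plusminus> \<i> b\<close>\<close>

text \<open>The derivative is asked for as the elementary \<open>g x\<close>, so that Bessel
  functions occur in the first premise only.\<close>

lemma indefinite_integrals_eqI:
  assumes "\<And>x. x > 0 \<Longrightarrow> f x = g x" "\<And>x. x > 0 \<Longrightarrow> (F has_vector_derivative g x) (at x)"
  shows "indefinite_integrals_eq f g F"
  using assms by (simp add: indefinite_integrals_eq_def)

lemma V_exp_imaginary:
  "V_exp a (\<i> * complex_of_real b) x = complex_of_real (exp (- a * x ^ 2)) * cis (- (b * x))"
  "V_exp a (- \<i> * complex_of_real b) x = complex_of_real (exp (- a * x ^ 2)) * cis (b * x)"
  unfolding V_exp_def cis_conv_exp exp_of_real[symmetric] exp_add[symmetric]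
  by (rule arg_cong[of _ _ exp]; simp add: algebra_simps)+

text \<open>The amplitude shared by both Bessel orders: under a single root everything cancels to 4,
  which is where the factor 2 in the elementary integrands comes from.\<close>

lemma bessel_prefactor:
  fixes b x :: real
  assumes "b > 0" and "x > 0"
  shows "sqrt (2 * pi) * sqrt x * sqrt b * sqrt (2 / (pi * (b * x))) = 2"
proof -
  have "sqrt (2 * pi) * sqrt x * sqrt b * sqrt (2 / (pi * (b * x))) =
      sqrt (2 * pi * x * b * (2 / (pi * (b * x))))"
    by (simp only: real_sqrt_mult)
  also have "2 * pi * x * b * (2 / (pi * (b * x))) = 2 ^ 2"
    using assms by simp
  finally show ?thesis by simp
qed

lemma bessel_J_one_half_integrand:
  fixes b x :: real and p :: int
  assumes "b > 0" and "x > 0"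
  shows "complex_of_real (sqrt (2 * pi)) *
      (complex_of_real (x powr (1 / 2 + of_int p) * w * b powr (1 / 2)) *
       bessel_J (1 / 2) (complex_of_real (b * x))) =
    complex_of_real (2 * w * x powi p * sin (b * x))"
proof -
  have "x powr (1 / 2 + of_int p) = sqrt x * x powi p" "b powr (1 / 2) = sqrt b"
    using assms by (simp_all add: powr_add powr_half_sqrt powr_real_of_int')
  then have "sqrt (2 * pi) * (x powr (1 / 2 + of_int p) * w * b powr (1 / 2) *
      (sqrt (2 / (pi * (b * x))) * sin (b * x))) =
    (sqrt (2 * pi) * sqrt x * sqrt b * sqrt (2 / (pi * (b * x)))) * w * x powi p * sin (b * x)"
    by (simp only: mult_ac)
  also have "\<dots> = 2 * w * x powi p * sin (b * x)"
    unfolding bessel_prefactor[OF assms] ..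
  finally show ?thesis
    using assms by (simp only: bessel_J_one_half[OF mult_pos_pos] of_real_mult[symmetric])
qed

text \<open>The exponent \<open>q\<close> is -1 in the second part and 0 in the third;
  \<open>w\<close> stands for the Gaussian. The factor \<open>b\<close> in the result is what
  \<open>b powr (3 / 2)\<close> leaves beside \<open>sqrt b\<close>.\<close>

lemma bessel_J_three_halves_integrand:
  fixes b q x :: real
  assumes "b > 0" and "x > 0"
  shows "complex_of_real (sqrt (2 * pi)) *
      (complex_of_real (x powr (1 / 2 + q) * w * b powr (3 / 2)) *
       bessel_J (3 / 2) (complex_of_real (b * x))) =
    complex_of_real (b * x powr q * w * (- 2 * cos (b * x) + 2 * sin (b * x) / (b * x)))"
proof -
  have "x powr (1 / 2 + q) = sqrt x * x powr q" "b powr (3 / 2) = b * sqrt b"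
    using assms powr_add[of b 1 "1 / 2"] by (simp_all add: powr_add powr_half_sqrt)
  then have "sqrt (2 * pi) * (x powr (1 / 2 + q) * w * b powr (3 / 2) *
      (sqrt (2 / (pi * (b * x))) * (sin (b * x) / (b * x) - cos (b * x)))) =
    (sqrt (2 * pi) * sqrt x * sqrt b * sqrt (2 / (pi * (b * x)))) * (b * x powr q * w *
      (sin (b * x) / (b * x) - cos (b * x)))"
    by (simp only: mult_ac)
  also have "\<dots> = b * x powr q * w * (- 2 * cos (b * x) + 2 * sin (b * x) / (b * x))"
    unfolding bessel_prefactor[OF assms] by (simp add: algebra_simps)
  finally show ?thesis
    using assms by (simp only: bessel_J_three_halves[OF mult_pos_pos] of_real_mult[symmetric])
qed

lemma V_sine_integral:
  assumes "a > 0" and "p \<in> {0, 1, 2}"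
  shows "((\<lambda>x. \<i> * V p 0 a (\<i> * complex_of_real b) x - \<i> * V p 0 a (- \<i> * complex_of_real b) x)
    has_vector_derivative complex_of_real (2 * exp (- a * x ^ 2) * x powi p * sin (b * x))) (at x)"
proof -
  let ?w = "complex_of_real (x powi p)" and ?e = "complex_of_real (exp (- a * x ^ 2))"
  have "((\<lambda>x. \<i> * V p 0 a (\<i> * complex_of_real b) x - \<i> * V p 0 a (- \<i> * complex_of_real b) x)
    has_vector_derivative \<i> * (?w * (?e * cis (- (b * x)))) - \<i> * (?w * (?e * cis (b * x)))) (at x)"
    unfolding V_exp_imaginary[symmetric]
    by (intro has_vector_derivative_diff has_vector_derivative_mult_right V_has_vector_derivative assms)
  also have "\<i> * (?w * (?e * cis (- (b * x)))) - \<i> * (?w * (?e * cis (b * x))) =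
      ?w * ?e * (\<i> * (cis (- (b * x)) - cis (b * x)))"
    by (simp add: algebra_simps)
  also have "\<i> * (cis (- (b * x)) - cis (b * x)) = complex_of_real (2 * sin (b * x))"
    by (simp add: complex_eq_iff)
  finally show ?thesis
    by (simp add: mult_ac)
qed

lemma V_minus_one_cosine_sine_integral:
  assumes "a > 0" and "b > 0" and "x > 0"
  shows "((\<lambda>x. \<i> * V (- 1) 1 a (\<i> * complex_of_real b) x - \<i> * V (- 1) 1 a (- \<i> * complex_of_real b) x)
    has_vector_derivative complex_of_real
      (b / x * exp (- a * x ^ 2) * (- 2 * cos (b * x) + 2 * sin (b * x) / (b * x)))) (at x)"
proof -
  let ?w = "complex_of_real (x ^ 2)" and ?e = "complex_of_real (exp (- a * x ^ 2))"
  let ?c = "(1 + \<i> * complex_of_real b * of_real x) * cis (- (b * x))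
      - (1 + - \<i> * complex_of_real b * of_real x) * cis (b * x)"
  have "((\<lambda>x. \<i> * V (- 1) 1 a (\<i> * complex_of_real b) x - \<i> * V (- 1) 1 a (- \<i> * complex_of_real b) x)
    has_vector_derivative \<i> * ((1 + \<i> * complex_of_real b * of_real x) / ?w * (?e * cis (- (b * x))))
     - \<i> * ((1 + - \<i> * complex_of_real b * of_real x) / ?w * (?e * cis (b * x)))) (at x)"
    unfolding V_exp_imaginary[symmetric]
    by (intro has_vector_derivative_diff has_vector_derivative_mult_right V_minus_one_has_vector_derivative assms)
  also have "\<i> * ((1 + \<i> * complex_of_real b * of_real x) / ?w * (?e * cis (- (b * x))))
     - \<i> * ((1 + - \<i> * complex_of_real b * of_real x) / ?w * (?e * cis (b * x))) = ?e / ?w * (\<i> * ?c)"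
    by (simp add: algebra_simps diff_divide_distrib add_divide_distrib)
  \<comment> \<open>The two terms of \<open>?c\<close> are complex conjugates, so their difference
    is purely imaginary.\<close>
  also have "\<i> * ?c = complex_of_real (2 * sin (b * x) - 2 * b * x * cos (b * x))"
    by (simp add: complex_eq_iff)
  also have "?e / ?w * \<dots> = complex_of_real
      (exp (- a * x ^ 2) / x ^ 2 * (2 * sin (b * x) - 2 * b * x * cos (b * x)))"
    by (simp only: of_real_mult of_real_divide)
  also have "exp (- a * x ^ 2) / x ^ 2 * (2 * sin (b * x) - 2 * b * x * cos (b * x)) =
      b / x * exp (- a * x ^ 2) * (- 2 * cos (b * x) + 2 * sin (b * x) / (b * x))"
    using assms by (simp add: field_simps power2_eq_square)
  finally show ?thesis .
qed

section \<open>Growth of the coefficients and the \<open>\<Upsilon>\<close> series\<close>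

text \<open>One factorial absorbs the growth of the incomplete Gamma values, and the other remains
  as a denominator, so an exponential series dominates.\<close>

lemma summable_mult_fact_power:
  fixes c :: "nat \<Rightarrow> real"
  assumes "\<And>k. \<bar>c k\<bar> * (fact k * fact k) \<le> M * B ^ k"
  shows "summable (\<lambda>k. \<bar>c k\<bar> * fact k * r ^ k)"
proof (rule summable_comparison_test)
  show "summable (\<lambda>k. M * ((B * \<bar>r\<bar>) ^ k / fact k))"
    using summable_exp[of "B * \<bar>r\<bar>"] by (intro summable_mult) (simp add: divide_inverse mult.commute)
  have "\<bar>c k\<bar> * fact k * \<bar>r\<bar> ^ k \<le> M * ((B * \<bar>r\<bar>) ^ k / fact k)" for k
    using mult_right_mono[OF assms[of k], of "\<bar>r\<bar> ^ k"] by (simp add: field_simps power_mult_distrib)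
  then show "\<exists>N. \<forall>k\<ge>N. norm (\<bar>c k\<bar> * fact k * r ^ k) \<le> M * ((B * \<bar>r\<bar>) ^ k / fact k)"
    by (simp add: abs_mult power_abs)
qed

text \<open>The quotient is a central binomial coefficient, hence a positive integer; divisibility
  gives the bound.\<close>

lemma fact_mult_self_le:
  "fact k * fact k \<le> (fact (2 * k) :: real)"
proof -
  have "(fact k * fact k :: nat) \<le> fact (2 * k)"
    using fact_fact_dvd_fact[of k k, where 'a = nat] by (simp add: dvd_imp_le mult_2)
  then show ?thesis
    by (metis of_nat_fact of_nat_le_iff of_nat_mult)
qed

lemma Upsilon_cosine_sine_integral:
  fixes a b x :: real
  assumes "a > 0" and "b > 0" and "x > 0"
  shows "((\<lambda>x. - 2 * complex_of_real b * Upsilon_e 0 a (\<i> * complex_of_real b) x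
             + 2 * \<i> * Upsilon_o 1 a (\<i> * complex_of_real b) x)
    has_vector_derivative complex_of_real
      (b * exp (- a * x ^ 2) * (- 2 * cos (b * x) + 2 * sin (b * x) / (b * x)))) (at x)"
proof -
  \<comment> \<open>The coefficients \<open>\<beta>^n / fact n\<close> at
    \<open>\<beta> = \<i> b\<close>, for even and odd \<open>n\<close>, with one factor
    \<open>\<i>\<close> taken out of the odd ones so that both sequences are real.\<close>
  define ce co where "ce = (\<lambda>k::nat. (- 1) ^ k * b ^ (2 * k) / fact (2 * k))"
    and "co = (\<lambda>k::nat. (- 1) ^ k * b ^ (2 * k + 1) / fact (2 * k + 1))"
  define T where "T = (\<lambda>c k x. c k * a powr (- (real k + 1 / 2)) * real_upper_Gamma (real k + 1 / 2) (a * x ^ 2) / 2)"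
  have ce: "summable (\<lambda>k. \<bar>ce k\<bar> * fact k * r ^ k)" for r
  proof (rule summable_mult_fact_power)
    show "\<bar>ce k\<bar> * (fact k * fact k) \<le> 1 * (b ^ 2) ^ k" for k
      using mult_left_mono[OF fact_mult_self_le[of k], of "b ^ (2 * k)"] assms
      by (simp add: ce_def abs_mult divide_le_eq power_mult)
  qed
  have co: "summable (\<lambda>k. \<bar>co k\<bar> * fact k * r ^ k)" for r
  proof (rule summable_mult_fact_power)
    show "\<bar>co k\<bar> * (fact k * fact k) \<le> b * (b ^ 2) ^ k" for k
    proof -
      have "fact k * fact k \<le> (fact (2 * k + 1) :: real)"
        using fact_mult_self_le[of k] fact_mono[of "2 * k" "2 * k + 1", where 'a = real] by linarith
      from mult_left_mono[OF this, of "b ^ (2 * k + 1)"] show ?thesis using assms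
        by (simp add: co_def abs_mult divide_le_eq power_mult del: fact_Suc)
    qed
  qed
  have series: "summable (\<lambda>k. T c k y)"
    "((\<lambda>x. \<Sum>k. T c k x) has_real_derivative - exp (- a * y ^ 2) * (\<Sum>k. c k * y ^ (2 * k))) (at y)"
    if "y > 0" "\<And>r. summable (\<lambda>k. \<bar>c k\<bar> * fact k * r ^ k)" for c y
    unfolding T_def by (rule upper_Gamma_series[OF assms(1) that])+
  have G: "upper_Gamma (of_nat k + 1 / 2) (a * y ^ 2) = of_real (real_upper_Gamma (real k + 1 / 2) (a * y ^ 2))"
    and P: "complex_of_real a powr (- of_nat k - 1 / 2) = of_real (a powr (- (real k + 1 / 2)))"
    if "y > 0" for k y
    using upper_Gamma_of_real[of "real k + 1 / 2" "a * y ^ 2"] powr_of_real[of a "- (real k + 1 / 2)"] assms that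
    by simp_all
  have ib: "(\<i> * complex_of_real b) ^ (2 * k) = of_real ((- 1) ^ k * b ^ (2 * k))" for k
    unfolding power_mult_distrib power_mult[of \<i>] by simp
  have Ue: "Upsilon_e 0 a (\<i> * complex_of_real b) y = - of_real (\<Sum>k. T ce k y)" if "y > 0" for y
  proof -
    have "(\<i> * complex_of_real b) ^ (2 * k) * complex_of_real a powr (- of_nat k + 0 / 2 - 1 / 2) *
         upper_Gamma (of_nat k - 0 / 2 + 1 / 2) (a * y ^ 2) / (2 * fact (2 * k)) = of_real (T ce k y)" for k
      using G[OF that, of k] P[OF that, of k]
      by (simp add: T_def ce_def ib)
    then show ?thesis
      unfolding Upsilon_e_def by (simp only: suminf_of_real[OF series(1)[OF that ce]])
  qed
  have Uo: "Upsilon_o 1 a (\<i> * complex_of_real b) y = \<i> * of_real (\<Sum>k. T co k y)" if "y > 0" for y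
  proof -
    have "(\<i> * complex_of_real b) ^ (2 * k + 1) * complex_of_real a powr (- of_nat k + 1 / 2 - 1) *
         upper_Gamma (of_nat k - 1 / 2 + 1) (a * y ^ 2) / (2 * fact (2 * k + 1)) = \<i> * of_real (T co k y)" for k
    proof -
      \<comment> \<open>Parameter 1 in the odd series yields the exponent and the Gamma argument of
        the even series with parameter 0.\<close>
      have eqs: "- of_nat k + 1 / 2 - 1 = (- of_nat k - 1 / 2 :: complex)"
        "of_nat k - 1 / 2 + 1 = (of_nat k + 1 / 2 :: complex)" by simp_all
      show ?thesis
        unfolding eqs G[OF that] P[OF that] by (simp add: T_def co_def ib del: fact_Suc) (simp add: mult_ac del: fact_Suc)
    qed
    then have "Upsilon_o 1 a (\<i> * complex_of_real b) y = (\<Sum>k. \<i> * of_real (T co k y))"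
      unfolding Upsilon_o_def by (simp only:)
    also have "\<dots> = \<i> * of_real (\<Sum>k. T co k y)"
      using series(1)[OF that co] by (subst suminf_mult) (auto simp: suminf_of_real summable_of_real)
    finally show ?thesis .
  qed
  have "(\<lambda>k. ce k * x ^ (2 * k)) sums cos (b * x)"
    using cos_paired[of "b * x"] by (simp add: ce_def power_mult_distrib mult_ac)
  then have se: "(\<Sum>k. ce k * x ^ (2 * k)) = cos (b * x)" by (simp add: sums_iff)
  have "(\<lambda>k. co k * x ^ (2 * k)) sums (sin (b * x) / x)"
    using sums_divide[OF sin_paired[of "b * x"], of x] assms
    by (simp add: co_def power_mult_distrib mult_ac del: fact_Suc)
  then have so: "(\<Sum>k. co k * x ^ (2 * k)) = sin (b * x) / x" by (simp add: sums_iff)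
  \<comment> \<open>The signs come from \<open>Ue\<close> and \<open>Uo\<close>: the minus sign in
    \<open>Upsilon_e\<close> turns \<open>- 2 * b\<close> into \<open>2 * b\<close>, and
    \<open>2 * \<i>\<close> times the extracted \<open>\<i>\<close> is -2.\<close>
  have "((\<lambda>x. 2 * b * (\<Sum>k. T ce k x) - 2 * (\<Sum>k. T co k x)) has_real_derivative
      2 * b * (- exp (- a * x ^ 2) * cos (b * x)) - 2 * (- exp (- a * x ^ 2) * (sin (b * x) / x))) (at x)"
    using series(2)[OF assms(3) ce] series(2)[OF assms(3) co] unfolding se so
    by (intro DERIV_diff DERIV_cmult)
  also have "2 * b * (- exp (- a * x ^ 2) * cos (b * x)) - 2 * (- exp (- a * x ^ 2) * (sin (b * x) / x)) =
      b * exp (- a * x ^ 2) * (- 2 * cos (b * x) + 2 * sin (b * x) / (b * x))"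
    using assms by (simp add: field_simps)
  finally have "((\<lambda>x. complex_of_real (2 * b * (\<Sum>k. T ce k x) - 2 * (\<Sum>k. T co k x))) has_vector_derivative
      complex_of_real (b * exp (- a * x ^ 2) * (- 2 * cos (b * x) + 2 * sin (b * x) / (b * x)))) (at x)"
    by (rule has_vector_derivative_of_real)
  then show ?thesis
  proof (rule has_vector_derivative_transform_within_open)
    show "open {0::real<..}" "x \<in> {0<..}" using assms by auto
    show "complex_of_real (2 * b * (\<Sum>k. T ce k y) - 2 * (\<Sum>k. T co k y)) =
        - 2 * complex_of_real b * Upsilon_e 0 a (\<i> * complex_of_real b) y
             + 2 * \<i> * Upsilon_o 1 a (\<i> * complex_of_real b) y" if "y \<in> {0<..}" for y
      using that by (simp add: Ue Uo)
  qed
qed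

theorem mainTheorem11:
  fixes a b :: real
  assumes "a > 0" and "b > 0"
  shows
    "((\<forall>p\<in>{0, 1, 2 :: int}.
        indefinite_integrals_eq
          (\<lambda>x. complex_of_real (sqrt (2 * pi)) *
             (complex_of_real (x powr (1 / 2 + of_int p) * exp (- a * x ^ 2) * b powr (1 / 2)) *
              bessel_J (1 / 2) (complex_of_real (b * x))))
          (\<lambda>x. complex_of_real (2 * exp (- a * x ^ 2) * x powi p * sin (b * x)))
          (\<lambda>x. \<i> * V p 0 a (\<i> * complex_of_real b) x - \<i> * V p 0 a (- \<i> * complex_of_real b) x))
     \<and> (\<forall>x>0. \<i> * V 0 0 a (\<i> * complex_of_real b) x - \<i> * V 0 0 a (- \<i> * complex_of_real b) x
          = \<i> * complex_of_real (sqrt pi) / complex_of_real (2 * sqrt a)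
            * complex_of_real (exp (- (b ^ 2 / (4 * a))))
            * (erf ((complex_of_real (2 * a * x) + \<i> * complex_of_real b) / complex_of_real (2 * sqrt a))
               - erf ((complex_of_real (2 * a * x) - \<i> * complex_of_real b) / complex_of_real (2 * sqrt a)))))
     \<and> (let F = (\<lambda>x. \<i> * complex_of_real (sqrt pi) * complex_of_real (sqrt a)
                * complex_of_real (exp (- (b ^ 2 / (4 * a))))
                * erf ((complex_of_real (2 * a * x) - \<i> * complex_of_real b) / complex_of_real (2 * sqrt a))
              - \<i> * complex_of_real (sqrt pi) * complex_of_real (sqrt a)
                * complex_of_real (exp (- (b ^ 2 / (4 * a))))
                * erf ((complex_of_real (2 * a * x) + \<i> * complex_of_real b) / complex_of_real (2 * sqrt a))
              + \<i> / complex_of_real x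
                * (exp (- complex_of_real (a * x ^ 2) + \<i> * complex_of_real (b * x))
                   - exp (- complex_of_real (a * x ^ 2) - \<i> * complex_of_real (b * x))))
     in indefinite_integrals_eq
          (\<lambda>x. complex_of_real (sqrt (2 * pi)) *
             (complex_of_real (x powr (1 / 2 - 1) * exp (- a * x ^ 2) * b powr (3 / 2)) *
              bessel_J (3 / 2) (complex_of_real (b * x))))
          (\<lambda>x. complex_of_real
             (b / x * exp (- a * x ^ 2) * (- 2 * cos (b * x) + 2 * sin (b * x) / (b * x))))
          F
        \<and> (\<forall>x>0. F x = \<i> * V (- 1) 1 a (\<i> * complex_of_real b) x
                        - \<i> * V (- 1) 1 a (- \<i> * complex_of_real b) x))
     \<and> indefinite_integrals_eq
       (\<lambda>x. complex_of_real (sqrt (2 * pi)) *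
          (complex_of_real (x powr (1 / 2) * exp (- a * x ^ 2) * b powr (3 / 2)) *
           bessel_J (3 / 2) (complex_of_real (b * x))))
       (\<lambda>x. complex_of_real
          (b * exp (- a * x ^ 2) * (- 2 * cos (b * x) + 2 * sin (b * x) / (b * x))))
       (\<lambda>x. - 2 * complex_of_real b * Upsilon_e 0 a (\<i> * complex_of_real b) x
             + 2 * \<i> * Upsilon_o 1 a (\<i> * complex_of_real b) x)"
proof (intro conjI ballI)
  \<comment> \<open>Both signs of \<open>\<beta>\<close> have the square \<open>- b^2\<close>, so
    the two \<open>V_erf\<close> values share one real exponential factor.\<close>
  have sq: "(\<i> * complex_of_real b) ^ 2 / complex_of_real (4 * a) = complex_of_real (- (b ^ 2 / (4 * a)))"
    "(- \<i> * complex_of_real b) ^ 2 / complex_of_real (4 * a) = complex_of_real (- (b ^ 2 / (4 * a)))"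
    by (simp_all add: power_mult_distrib)
  have W: "V_erf a (\<i> * complex_of_real b) x = complex_of_real (sqrt pi) *
        complex_of_real (exp (- (b ^ 2 / (4 * a)))) *
        erf ((complex_of_real (2 * a * x) + \<i> * complex_of_real b) / complex_of_real (2 * sqrt a))"
    "V_erf a (- \<i> * complex_of_real b) x = complex_of_real (sqrt pi) *
        complex_of_real (exp (- (b ^ 2 / (4 * a)))) *
        erf ((complex_of_real (2 * a * x) - \<i> * complex_of_real b) / complex_of_real (2 * sqrt a))" for x
    unfolding V_erf_def sq exp_of_real by simp_all
  show "indefinite_integrals_eq
          (\<lambda>x. complex_of_real (sqrt (2 * pi)) *
             (complex_of_real (x powr (1 / 2 + of_int p) * exp (- a * x ^ 2) * b powr (1 / 2)) *
              bessel_J (1 / 2) (complex_of_real (b * x))))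
          (\<lambda>x. complex_of_real (2 * exp (- a * x ^ 2) * x powi p * sin (b * x)))
          (\<lambda>x. \<i> * V p 0 a (\<i> * complex_of_real b) x - \<i> * V p 0 a (- \<i> * complex_of_real b) x)"
    if "p \<in> {0, 1, 2}" for p
    by (rule indefinite_integrals_eqI bessel_J_one_half_integrand V_sine_integral assms that | assumption)+
  show "\<forall>x>0. \<i> * V 0 0 a (\<i> * complex_of_real b) x - \<i> * V 0 0 a (- \<i> * complex_of_real b) x
          = \<i> * complex_of_real (sqrt pi) / complex_of_real (2 * sqrt a)
            * complex_of_real (exp (- (b ^ 2 / (4 * a))))
            * (erf ((complex_of_real (2 * a * x) + \<i> * complex_of_real b) / complex_of_real (2 * sqrt a))
               - erf ((complex_of_real (2 * a * x) - \<i> * complex_of_real b) / complex_of_real (2 * sqrt a)))"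
  proof -
    have "V 0 0 a \<beta> x = V_erf a \<beta> x / complex_of_real (2 * sqrt a)" for \<beta> x
      by (simp add: V_def)
    moreover have "\<i> * (s * e * u / d) - \<i> * (s * e * v / d) = \<i> * s / d * e * (u - v)" for s e u v d :: complex
      by (simp add: right_diff_distrib diff_divide_distrib mult_ac)
    ultimately show ?thesis by (simp only: W simp_thms)
  qed
  have E: "V_exp a (\<i> * complex_of_real b) x = exp (- complex_of_real (a * x ^ 2) - \<i> * complex_of_real (b * x))"
    "V_exp a (- \<i> * complex_of_real b) x = exp (- complex_of_real (a * x ^ 2) + \<i> * complex_of_real (b * x))" for x
    by (simp_all add: V_exp_def mult_ac)
  define F where "F = (\<lambda>x. \<i> * complex_of_real (sqrt pi) * complex_of_real (sqrt a)
                * complex_of_real (exp (- (b ^ 2 / (4 * a))))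
                * erf ((complex_of_real (2 * a * x) - \<i> * complex_of_real b) / complex_of_real (2 * sqrt a))
              - \<i> * complex_of_real (sqrt pi) * complex_of_real (sqrt a)
                * complex_of_real (exp (- (b ^ 2 / (4 * a))))
                * erf ((complex_of_real (2 * a * x) + \<i> * complex_of_real b) / complex_of_real (2 * sqrt a))
              + \<i> / complex_of_real x
                * (exp (- complex_of_real (a * x ^ 2) + \<i> * complex_of_real (b * x))
                   - exp (- complex_of_real (a * x ^ 2) - \<i> * complex_of_real (b * x))))"
  \<comment> \<open>This is an equality of functions on the whole line: at 0 the quotients by
    \<open>x\<close> are 0 on both sides. It can therefore be rewritten inside the derivative
    statement.\<close>
  have F: "F = (\<lambda>x. \<i> * V (- 1) 1 a (\<i> * complex_of_real b) x - \<i> * V (- 1) 1 a (- \<i> * complex_of_real b) x)"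
  proof -
    have "V (- 1) 1 a \<beta> x = - complex_of_real (sqrt a) * V_erf a \<beta> x - V_exp a \<beta> x / complex_of_real x" for \<beta> x
      by (simp add: V_def)
    moreover have "\<i> * (- t * (s * e * u) - m / x) - \<i> * (- t * (s * e * v) - n / x) =
        \<i> * s * t * e * v - \<i> * s * t * e * u + \<i> / x * (n - m)" for s t e u v m n x :: complex
      by (simp add: algebra_simps diff_divide_distrib)
    ultimately show ?thesis by (simp only: F_def W E)
  qed
  have f: "complex_of_real (sqrt (2 * pi)) *
             (complex_of_real (x powr (1 / 2 - 1) * exp (- a * x ^ 2) * b powr (3 / 2)) *
              bessel_J (3 / 2) (complex_of_real (b * x))) = complex_of_real
             (b / x * exp (- a * x ^ 2) * (- 2 * cos (b * x) + 2 * sin (b * x) / (b * x)))" if "x > 0" for x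
    using bessel_J_three_halves_integrand[OF assms(2) that, of "- 1" "exp (- a * x ^ 2)"] that
    by (simp add: powr_minus_divide)
  show "let F = (\<lambda>x. \<i> * complex_of_real (sqrt pi) * complex_of_real (sqrt a)
                * complex_of_real (exp (- (b ^ 2 / (4 * a))))
                * erf ((complex_of_real (2 * a * x) - \<i> * complex_of_real b) / complex_of_real (2 * sqrt a))
              - \<i> * complex_of_real (sqrt pi) * complex_of_real (sqrt a)
                * complex_of_real (exp (- (b ^ 2 / (4 * a))))
                * erf ((complex_of_real (2 * a * x) + \<i> * complex_of_real b) / complex_of_real (2 * sqrt a))
              + \<i> / complex_of_real x
                * (exp (- complex_of_real (a * x ^ 2) + \<i> * complex_of_real (b * x))
                   - exp (- complex_of_real (a * x ^ 2) - \<i> * complex_of_real (b * x))))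
     in indefinite_integrals_eq
          (\<lambda>x. complex_of_real (sqrt (2 * pi)) *
             (complex_of_real (x powr (1 / 2 - 1) * exp (- a * x ^ 2) * b powr (3 / 2)) *
              bessel_J (3 / 2) (complex_of_real (b * x))))
          (\<lambda>x. complex_of_real
             (b / x * exp (- a * x ^ 2) * (- 2 * cos (b * x) + 2 * sin (b * x) / (b * x))))
          F
        \<and> (\<forall>x>0. F x = \<i> * V (- 1) 1 a (\<i> * complex_of_real b) x
                        - \<i> * V (- 1) 1 a (- \<i> * complex_of_real b) x)"
    unfolding F_def[symmetric] Let_def
  proof (intro conjI allI impI indefinite_integrals_eqI)
    fix x :: real assume x: "x > 0"
    show "F x = \<i> * V (- 1) 1 a (\<i> * complex_of_real b) x - \<i> * V (- 1) 1 a (- \<i> * complex_of_real b) x"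
      unfolding F ..
    show "(F has_vector_derivative complex_of_real
        (b / x * exp (- a * x ^ 2) * (- 2 * cos (b * x) + 2 * sin (b * x) / (b * x)))) (at x)"
      unfolding F by (rule V_minus_one_cosine_sine_integral[OF assms x])
  qed (rule f)
  show "indefinite_integrals_eq
       (\<lambda>x. complex_of_real (sqrt (2 * pi)) *
          (complex_of_real (x powr (1 / 2) * exp (- a * x ^ 2) * b powr (3 / 2)) *
           bessel_J (3 / 2) (complex_of_real (b * x))))
       (\<lambda>x. complex_of_real
          (b * exp (- a * x ^ 2) * (- 2 * cos (b * x) + 2 * sin (b * x) / (b * x))))
       (\<lambda>x. - 2 * complex_of_real b * Upsilon_e 0 a (\<i> * complex_of_real b) x
             + 2 * \<i> * Upsilon_o 1 a (\<i> * complex_of_real b) x)"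
  proof (rule indefinite_integrals_eqI)
    fix x :: real assume x: "x > 0"
    show "complex_of_real (sqrt (2 * pi)) *
          (complex_of_real (x powr (1 / 2) * exp (- a * x ^ 2) * b powr (3 / 2)) *
           bessel_J (3 / 2) (complex_of_real (b * x))) = complex_of_real
          (b * exp (- a * x ^ 2) * (- 2 * cos (b * x) + 2 * sin (b * x) / (b * x)))"
      using bessel_J_three_halves_integrand[OF assms(2) x, of 0 "exp (- a * x ^ 2)"] x by simp
  qed (rule Upsilon_cosine_sine_integral[OF assms])
qed

end
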